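(* Let $K$ be a field of characteristic $0$, let $X$ be a countably infinite set, and let $\mathcal{A}s_2\langle X\rangle$ be the free second-type associative algebra generated by $X$. Let $\mathcal{A}s_2^{(-)}\langle X\rangle$ be the same vector space with the commutator operation $[a,b]=ab-ba$. Then all polynomial identities of degree at most $4$ satisfied by the algebra $\mathcal{A}s_2^{(-)}\langle X\rangle$ follow from anti-commutativity $[a,b]=-[b,a]$, the Jacobi identity $[[a,b],c]+[[b,c],a]+[[c,a],b]=0$, and the metabelian identity (all of which hold in $\mathcal{A}s_2^{(-)}\langle X\rangle$) $$[[a,b],[c,d]]=0.$$
   Context: A second-type associative algebra is an associative (not necessarily unital) $K$-algebra satisfying the identity $abc-bac-acb+cab+bca-cba=0$; $\mathcal{A}s_2$ is the variety of all such algebras and $\mathcal{A}s_2\langle X\rangle$ is the free algebra of this variety on $X$. A polynomial identity of an algebra with one bilinear operation $[\cdot,\cdot]$ is an element $f$ of the free nonassociative (magmatic) algebra in that operation that vanishes under every substitution of elements of the algebra for the variables. An identity follows from given identities if it lies in the ideal of the free nonassociative algebra, closed under all substitutions (T-ideal), generated by them. *)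

theory Defs
  imports Complex_Main "HOL-Library.Poly_Mapping" "HOL-Library.Countable_Set"
begin

section \<open>Algebras with one bilinear operation\<close>

locale nonassoc_algebra = vector_space scale
  for scale :: "'k::field \<Rightarrow> 'a::ab_group_add \<Rightarrow> 'a" +
  fixes mul :: "'a \<Rightarrow> 'a \<Rightarrow> 'a"
  assumes mul_add_left: "mul (a + b) c = mul a c + mul b c"
    and mul_add_right: "mul a (b + c) = mul a b + mul a c"
    and mul_scale_left: "mul (scale k a) b = scale k (mul a b)"
    and mul_scale_right: "mul a (scale k b) = scale k (mul a b)"

locale second_type_assoc_algebra = nonassoc_algebra scale mul
  for scale :: "'k::field \<Rightarrow> 'a::ab_group_add \<Rightarrow> 'a"
    and mul :: "'a \<Rightarrow> 'a \<Rightarrow> 'a" +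
  assumes mul_assoc: "mul (mul a b) c = mul a (mul b c)"
    and second_type:
      "mul (mul a b) c - mul (mul b a) c - mul (mul a c) b
       + mul (mul c a) b + mul (mul b c) a - mul (mul c b) a = 0"


section \<open>The free nonassociative algebra\<close>

datatype 'x magma = Gen 'x | Op "'x magma" "'x magma"

fun leaves :: "'x magma \<Rightarrow> nat" where
  "leaves (Gen x) = 1"
| "leaves (Op s t) = leaves s + leaves t"

fun magma_eval :: "('a \<Rightarrow> 'a \<Rightarrow> 'a) \<Rightarrow> ('x \<Rightarrow> 'a) \<Rightarrow> 'x magma \<Rightarrow> 'a" where
  "magma_eval mul \<phi> (Gen x) = \<phi> x"
| "magma_eval mul \<phi> (Op s t) = mul (magma_eval mul \<phi> s) (magma_eval mul \<phi> t)"

type_synonym ('x, 'k) free_nonassoc = "'x magma \<Rightarrow>\<^sub>0 'k"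

definition fscale :: "'k \<Rightarrow> ('x, 'k::field) free_nonassoc \<Rightarrow> ('x, 'k) free_nonassoc" where
  "fscale c f = Poly_Mapping.map ((*) c) f"

definition fmul :: "('x, 'k::field) free_nonassoc \<Rightarrow> ('x, 'k) free_nonassoc \<Rightarrow> ('x, 'k) free_nonassoc"
    (infixl "\<odot>" 70) where
  "f \<odot> g = (\<Sum>s\<in>Poly_Mapping.keys f. \<Sum>t\<in>Poly_Mapping.keys g.
     Poly_Mapping.single (Op s t) (Poly_Mapping.lookup f s * Poly_Mapping.lookup g t))"

definition fvar :: "'x \<Rightarrow> ('x, 'k::field) free_nonassoc" where
  "fvar x = Poly_Mapping.single (Gen x) 1"

text \<open>The zero polynomial gets degree \<open>0\<close>.\<close>

definition fdegree :: "('x, 'k::field) free_nonassoc \<Rightarrow> nat" where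
  "fdegree f = Max (insert 0 (leaves ` Poly_Mapping.keys f))"

definition feval :: "('k::field \<Rightarrow> 'a::ab_group_add \<Rightarrow> 'a) \<Rightarrow> ('a \<Rightarrow> 'a \<Rightarrow> 'a) \<Rightarrow> ('x \<Rightarrow> 'a) \<Rightarrow>
    ('x, 'k) free_nonassoc \<Rightarrow> 'a" where
  "feval scale mul \<phi> f =
     (\<Sum>t\<in>Poly_Mapping.keys f. scale (Poly_Mapping.lookup f t) (magma_eval mul \<phi> t))"

definition is_identity :: "('k::field \<Rightarrow> 'a::ab_group_add \<Rightarrow> 'a) \<Rightarrow> ('a \<Rightarrow> 'a \<Rightarrow> 'a) \<Rightarrow>
    ('x, 'k) free_nonassoc \<Rightarrow> bool" where
  "is_identity scale mul f \<longleftrightarrow> (\<forall>\<phi>. feval scale mul \<phi> f = 0)"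

lemma lookup_fscale [simp]: "Poly_Mapping.lookup (fscale c f) t = c * Poly_Mapping.lookup f t"
  by (simp add: fscale_def Poly_Mapping.map.rep_eq when_def)

lemma fmul_superset:
  assumes "finite A" "finite B" "Poly_Mapping.keys f \<subseteq> A" "Poly_Mapping.keys g \<subseteq> B"
  shows "f \<odot> g = (\<Sum>s\<in>A. \<Sum>t\<in>B.
     Poly_Mapping.single (Op s t) (Poly_Mapping.lookup f s * Poly_Mapping.lookup g t))"
proof -
  have "f \<odot> g = (\<Sum>s\<in>Poly_Mapping.keys f. \<Sum>t\<in>B.
     Poly_Mapping.single (Op s t) (Poly_Mapping.lookup f s * Poly_Mapping.lookup g t))"
    unfolding fmul_def using assms
    by (intro sum.cong refl sum.mono_neutral_left) (auto simp: in_keys_iff)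
  also have "\<dots> = (\<Sum>s\<in>A. \<Sum>t\<in>B.
     Poly_Mapping.single (Op s t) (Poly_Mapping.lookup f s * Poly_Mapping.lookup g t))"
    using assms by (intro sum.mono_neutral_left) (auto simp: in_keys_iff)
  finally show ?thesis .
qed

lemma fscale_single: "fscale c (Poly_Mapping.single t a) = Poly_Mapping.single t (c * a)"
  by (rule poly_mapping_eqI) (simp add: lookup_single when_def)

lemma keys_fscale: "Poly_Mapping.keys (fscale c f) \<subseteq> Poly_Mapping.keys f"
  by (auto simp: in_keys_iff)

interpretation free_vs: vector_space "fscale :: 'k::field \<Rightarrow> ('x, 'k) free_nonassoc \<Rightarrow> _"
  by standard (auto intro!: poly_mapping_eqI simp: lookup_add algebra_simps)

interpretation free_alg: nonassoc_algebra "fscale :: 'k::field \<Rightarrow> ('x, 'k) free_nonassoc \<Rightarrow> _" fmul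
proof
  fix a b c :: "('x, 'k) free_nonassoc" and k :: 'k
  let ?U = "Poly_Mapping.keys a \<union> Poly_Mapping.keys b \<union> Poly_Mapping.keys c"
  have U: "finite ?U" by simp
  have ab: "Poly_Mapping.keys (a + b) \<subseteq> ?U" using Poly_Mapping.keys_add[of a b] by blast
  have bc: "Poly_Mapping.keys (b + c) \<subseteq> ?U" using Poly_Mapping.keys_add[of b c] by blast
  have ka: "Poly_Mapping.keys (fscale k a) \<subseteq> ?U" using keys_fscale[of k a] by blast
  have kb: "Poly_Mapping.keys (fscale k b) \<subseteq> ?U" using keys_fscale[of k b] by blast
  have a: "Poly_Mapping.keys a \<subseteq> ?U" and b: "Poly_Mapping.keys b \<subseteq> ?U"
    and c: "Poly_Mapping.keys c \<subseteq> ?U" by auto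
  show "(a + b) \<odot> c = a \<odot> c + b \<odot> c"
    unfolding fmul_superset[OF U U ab c] fmul_superset[OF U U a c] fmul_superset[OF U U b c]
    by (simp add: lookup_add algebra_simps single_add sum.distrib)
  show "a \<odot> (b + c) = a \<odot> b + a \<odot> c"
    unfolding fmul_superset[OF U U a bc] fmul_superset[OF U U a b] fmul_superset[OF U U a c]
    by (simp add: lookup_add algebra_simps single_add sum.distrib)
  show "fscale k a \<odot> b = fscale k (a \<odot> b)"
    unfolding fmul_superset[OF U U ka b] fmul_superset[OF U U a b]
    by (simp add: free_vs.scale_sum_right fscale_single mult_ac)
  show "a \<odot> fscale k b = fscale k (a \<odot> b)"
    unfolding fmul_superset[OF U U a kb] fmul_superset[OF U U a b]
    by (simp add: free_vs.scale_sum_right fscale_single mult_ac)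
qed

lemma fmul_single [simp]:
  "Poly_Mapping.single s a \<odot> Poly_Mapping.single t b = Poly_Mapping.single (Op s t) (a * b)"
  by (subst fmul_superset[of "{s}" "{t}"]) auto

context nonassoc_algebra
begin

lemma mul_zero [simp]: "mul 0 a = 0" "mul a 0 = 0"
  using mul_scale_left[of 0 0 a] mul_scale_right[of a 0 0] by simp_all

lemma mul_sum_left: "mul (sum f A) b = (\<Sum>i\<in>A. mul (f i) b)"
  by (induction A rule: infinite_finite_induct) (simp_all add: mul_add_left)

lemma mul_sum_right: "mul b (sum f A) = (\<Sum>i\<in>A. mul b (f i))"
  by (induction A rule: infinite_finite_induct) (simp_all add: mul_add_right)

lemma feval_superset:
  assumes "finite A" "Poly_Mapping.keys f \<subseteq> A"
  shows "feval scale mul \<phi> f = (\<Sum>t\<in>A. scale (Poly_Mapping.lookup f t) (magma_eval mul \<phi> t))"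
  unfolding feval_def using assms by (intro sum.mono_neutral_left) (auto simp: in_keys_iff)

lemma feval_single: "feval scale mul \<phi> (Poly_Mapping.single t a) = scale a (magma_eval mul \<phi> t)"
  by (subst feval_superset[of "{t}"]) auto

lemma feval_fvar [simp]: "feval scale mul \<phi> (fvar x) = \<phi> x"
  by (simp add: fvar_def feval_single)

lemma feval_zero [simp]: "feval scale mul \<phi> 0 = 0"
  by (simp add: feval_def)

lemma feval_add: "feval scale mul \<phi> (f + g) = feval scale mul \<phi> f + feval scale mul \<phi> g"
proof -
  let ?U = "Poly_Mapping.keys f \<union> Poly_Mapping.keys g"
  have "finite ?U" "Poly_Mapping.keys (f + g) \<subseteq> ?U" by (simp_all add: Poly_Mapping.keys_add)
  then show ?thesis
    by (simp add: feval_superset[of ?U] lookup_add scale_left_distrib sum.distrib)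
qed

lemma feval_fscale: "feval scale mul \<phi> (fscale c f) = scale c (feval scale mul \<phi> f)"
  using feval_superset[OF _ keys_fscale[of c f]]
  by (simp add: feval_def scale_sum_right)

lemma feval_uminus: "feval scale mul \<phi> (- f) = - feval scale mul \<phi> f"
  using feval_add[of \<phi> f "- f"] by (simp add: eq_neg_iff_add_eq_0 add.commute)

lemma feval_diff: "feval scale mul \<phi> (f - g) = feval scale mul \<phi> f - feval scale mul \<phi> g"
  using feval_add[of \<phi> f "- g"] by (simp add: feval_uminus)

lemma feval_sum: "feval scale mul \<phi> (sum f A) = (\<Sum>i\<in>A. feval scale mul \<phi> (f i))"
  by (induction A rule: infinite_finite_induct) (simp_all add: feval_add)

lemma feval_fmul: "feval scale mul \<phi> (f \<odot> g) = mul (feval scale mul \<phi> f) (feval scale mul \<phi> g)"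
  unfolding fmul_def
  by (simp add: feval_sum feval_single)
    (simp only: feval_def mul_sum_left, simp add: mul_sum_right mul_scale_left mul_scale_right
      scale_sum_right mult.commute)

end


section \<open>Ideals and T-ideals\<close>

definition is_ideal :: "('x, 'k::field) free_nonassoc set \<Rightarrow> bool" where
  "is_ideal I \<longleftrightarrow> 0 \<in> I \<and> (\<forall>f\<in>I. \<forall>g\<in>I. f + g \<in> I) \<and> (\<forall>c. \<forall>f\<in>I. fscale c f \<in> I) \<and>
     (\<forall>f\<in>I. \<forall>g. f \<odot> g \<in> I \<and> g \<odot> f \<in> I)"

definition is_T_ideal :: "('x, 'k::field) free_nonassoc set \<Rightarrow> bool" where
  "is_T_ideal I \<longleftrightarrow> is_ideal I \<and> (\<forall>\<sigma>. \<forall>f\<in>I. feval fscale fmul \<sigma> f \<in> I)"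

definition ideal_generated :: "('x, 'k::field) free_nonassoc set \<Rightarrow> ('x, 'k) free_nonassoc set" where
  "ideal_generated G = \<Inter>{I. is_ideal I \<and> G \<subseteq> I}"

definition T_ideal_generated :: "('x, 'k::field) free_nonassoc set \<Rightarrow> ('x, 'k) free_nonassoc set" where
  "T_ideal_generated G = \<Inter>{I. is_T_ideal I \<and> G \<subseteq> I}"

lemma is_ideal_generated: "is_ideal (ideal_generated G)"
  unfolding is_ideal_def ideal_generated_def by blast

lemma ideal_generated_superset: "G \<subseteq> ideal_generated G"
  unfolding ideal_generated_def by blast

lemma is_ideal_diff:
  assumes "is_ideal I" "f \<in> I" "g \<in> I"
  shows "f - g \<in> I"
proof -
  have "fscale (-1) g \<in> I" using assms unfolding is_ideal_def by blast
  then have "f + fscale (-1) g \<in> I" using assms unfolding is_ideal_def by blast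
  then show ?thesis by simp
qed


section \<open>The free second-type associative algebra\<close>

text \<open>All values of the two defining identities are taken as generators, so that the ideal they
  generate is the verbal ideal of the variety for an arbitrary set of generators.\<close>

definition second_type_relators :: "('x, 'k::field) free_nonassoc set" where
  "second_type_relators =
     {(a \<odot> b) \<odot> c - a \<odot> (b \<odot> c) | a b c. True} \<union>
     {a \<odot> b \<odot> c - b \<odot> a \<odot> c - a \<odot> c \<odot> b + c \<odot> a \<odot> b + b \<odot> c \<odot> a - c \<odot> b \<odot> a | a b c. True}"

definition as2_ideal :: "('x, 'k::field) free_nonassoc set" where
  "as2_ideal = ideal_generated second_type_relators"

definition as2_rel :: "('x, 'k::field) free_nonassoc \<Rightarrow> ('x, 'k) free_nonassoc \<Rightarrow> bool" where
  "as2_rel f g \<longleftrightarrow> f - g \<in> as2_ideal"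

lemma as2_ideal_zero [simp]: "0 \<in> as2_ideal"
  and as2_ideal_add: "f \<in> as2_ideal \<Longrightarrow> g \<in> as2_ideal \<Longrightarrow> f + g \<in> as2_ideal"
  and as2_ideal_diff: "f \<in> as2_ideal \<Longrightarrow> g \<in> as2_ideal \<Longrightarrow> f - g \<in> as2_ideal"
  and as2_ideal_fscale: "f \<in> as2_ideal \<Longrightarrow> fscale c f \<in> as2_ideal"
  and as2_ideal_mul_left: "f \<in> as2_ideal \<Longrightarrow> h \<odot> f \<in> as2_ideal"
  and as2_ideal_mul_right: "f \<in> as2_ideal \<Longrightarrow> f \<odot> h \<in> as2_ideal"
  using is_ideal_generated[of second_type_relators, folded as2_ideal_def] is_ideal_diff
  unfolding is_ideal_def by blast+

lemma fmul_diff_left: "(f - g) \<odot> h = f \<odot> h - g \<odot> h"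
  using free_alg.mul_add_left[of "f - g" g h] by (simp add: eq_diff_eq)

lemma fmul_diff_right: "h \<odot> (f - g) = h \<odot> f - h \<odot> g"
  using free_alg.mul_add_right[of h "f - g" g] by (simp add: eq_diff_eq)

lemma equivp_as2_rel: "equivp as2_rel"
proof (intro equivpI reflpI sympI transpI)
  fix f g h :: "('x, 'k::field) free_nonassoc"
  show "as2_rel f f" by (simp add: as2_rel_def)
  show "as2_rel g f" if "as2_rel f g"
    using that as2_ideal_diff[OF as2_ideal_zero, of "f - g"] by (simp add: as2_rel_def)
  show "as2_rel f h" if "as2_rel f g" "as2_rel g h"
    using that as2_ideal_add[of "f - g" "g - h"] by (simp add: as2_rel_def)
qed

quotient_type (overloaded) ('x, 'k) as2 = "('x, 'k::field) free_nonassoc" / as2_rel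
  by (rule equivp_as2_rel)

lemma as2_abs_cases:
  obtains f where "a = abs_as2 f"
  by (rule that[of "rep_as2 a"]) (rule Quotient3_abs_rep[OF Quotient3_as2, symmetric])

instantiation as2 :: (type, field) ring
begin

lift_definition zero_as2 :: "('a, 'b) as2" is 0 .

lift_definition plus_as2 :: "('a, 'b) as2 \<Rightarrow> ('a, 'b) as2 \<Rightarrow> ('a, 'b) as2" is "(+)"
proof -
  fix f f' g g' :: "('a, 'b) free_nonassoc" assume "as2_rel f f'" "as2_rel g g'"
  then have "(f - f') + (g - g') \<in> as2_ideal" unfolding as2_rel_def by (rule as2_ideal_add)
  then show "as2_rel (f + g) (f' + g')" by (simp add: as2_rel_def algebra_simps)
qed

lift_definition minus_as2 :: "('a, 'b) as2 \<Rightarrow> ('a, 'b) as2 \<Rightarrow> ('a, 'b) as2" is "(-)"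
proof -
  fix f f' g g' :: "('a, 'b) free_nonassoc" assume "as2_rel f f'" "as2_rel g g'"
  then have "(f - f') - (g - g') \<in> as2_ideal" unfolding as2_rel_def by (rule as2_ideal_diff)
  then show "as2_rel (f - g) (f' - g')" by (simp add: as2_rel_def algebra_simps)
qed

lift_definition uminus_as2 :: "('a, 'b) as2 \<Rightarrow> ('a, 'b) as2" is uminus
proof -
  fix f f' :: "('a, 'b) free_nonassoc" assume "as2_rel f f'"
  then have "0 - (f - f') \<in> as2_ideal"
    unfolding as2_rel_def by (rule as2_ideal_diff[OF as2_ideal_zero])
  then show "as2_rel (- f) (- f')" by (simp add: as2_rel_def)
qed

lift_definition times_as2 :: "('a, 'b) as2 \<Rightarrow> ('a, 'b) as2 \<Rightarrow> ('a, 'b) as2" is fmul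
proof -
  fix f f' g g' :: "('a, 'b) free_nonassoc" assume "as2_rel f f'" "as2_rel g g'"
  then have "(f - f') \<odot> g + f' \<odot> (g - g') \<in> as2_ideal"
    unfolding as2_rel_def by (intro as2_ideal_add as2_ideal_mul_left as2_ideal_mul_right)
  then show "as2_rel (f \<odot> g) (f' \<odot> g')"
    by (simp add: as2_rel_def fmul_diff_left fmul_diff_right)
qed

instance
proof
  fix a b c :: "('a, 'b) as2"
  show "a * b * c = a * (b * c)"
  proof (transfer, unfold as2_rel_def as2_ideal_def)
    fix a b c :: "('a, 'b) free_nonassoc"
    have "a \<odot> b \<odot> c - a \<odot> (b \<odot> c) \<in> second_type_relators"
      unfolding second_type_relators_def by blast
    then show "a \<odot> b \<odot> c - a \<odot> (b \<odot> c) \<in> ideal_generated second_type_relators"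
      using ideal_generated_superset by blast
  qed
qed (transfer; simp add: as2_rel_def as2_ideal_zero algebra_simps
       free_alg.mul_add_left free_alg.mul_add_right)+

end

lift_definition as2_scale :: "'k::field \<Rightarrow> ('x, 'k) as2 \<Rightarrow> ('x, 'k) as2" is fscale
proof -
  fix c and f f' :: "('x, 'k) free_nonassoc" assume "as2_rel f f'"
  then have "fscale c (f - f') \<in> as2_ideal" unfolding as2_rel_def by (rule as2_ideal_fscale)
  then show "as2_rel (fscale c f) (fscale c f')"
    by (simp add: as2_rel_def free_vs.scale_right_diff_distrib)
qed

lift_definition as2_gen :: "'x \<Rightarrow> ('x, 'k::field) as2" is fvar .

interpretation as2: second_type_assoc_algebra "as2_scale :: 'k::field \<Rightarrow> ('x, 'k) as2 \<Rightarrow> _" "(*)"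
proof
  fix a b c :: "('x, 'k) as2"
  show "a * b * c - b * a * c - a * c * b + c * a * b + b * c * a - c * b * a = 0"
  proof (transfer, unfold as2_rel_def as2_ideal_def diff_zero)
    fix a b c :: "('x, 'k) free_nonassoc"
    have "a \<odot> b \<odot> c - b \<odot> a \<odot> c - a \<odot> c \<odot> b + c \<odot> a \<odot> b + b \<odot> c \<odot> a - c \<odot> b \<odot> a
            \<in> second_type_relators"
      unfolding second_type_relators_def by blast
    then show "a \<odot> b \<odot> c - b \<odot> a \<odot> c - a \<odot> c \<odot> b + c \<odot> a \<odot> b + b \<odot> c \<odot> a - c \<odot> b \<odot> a
            \<in> ideal_generated second_type_relators"
      using ideal_generated_superset by blast
  qed
qed (rule distrib_left distrib_right mult.assoc |
     (transfer, simp add: as2_rel_def as2_ideal_zero free_vs.scale_right_distrib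
       free_vs.scale_left_distrib free_alg.mul_scale_left free_alg.mul_scale_right))+

text \<open>The universal property of the free algebra of the variety.\<close>

definition is_alg_hom :: "('k \<Rightarrow> 'a \<Rightarrow> 'a) \<Rightarrow> ('a \<Rightarrow> 'a \<Rightarrow> 'a) \<Rightarrow> ('k \<Rightarrow> 'b \<Rightarrow> 'b) \<Rightarrow> ('b \<Rightarrow> 'b \<Rightarrow> 'b) \<Rightarrow>
    ('a::ab_group_add \<Rightarrow> 'b::ab_group_add) \<Rightarrow> bool" where
  "is_alg_hom scale mul scale' mul' h \<longleftrightarrow>
     (\<forall>a b. h (a + b) = h a + h b) \<and> (\<forall>c a. h (scale c a) = scale' c (h a)) \<and>
     (\<forall>a b. h (mul a b) = mul' (h a) (h b))"

lemma free_nonassoc_sum: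
  fixes f :: "('x, 'k::field) free_nonassoc"
  shows "f = (\<Sum>t\<in>Poly_Mapping.keys f. fscale (Poly_Mapping.lookup f t) (Poly_Mapping.single t 1))"
  by (rule poly_mapping_eqI)
    (simp add: lookup_sum lookup_single when_def in_keys_iff if_distrib cong: if_cong)

lemma alg_hom_unique_free:
  fixes h h' :: "('x, 'k::field) free_nonassoc \<Rightarrow> 'b::ab_group_add"
  assumes "is_alg_hom fscale fmul scale' mul' h" "is_alg_hom fscale fmul scale' mul' h'"
    and "\<And>x. h (fvar x) = h' (fvar x)"
  shows "h f = h' f"
proof -
  have mono: "h (Poly_Mapping.single t 1) = h' (Poly_Mapping.single t 1)" for t
  proof (induction t)
    case (Gen x)
    then show ?case using assms(3) by (simp add: fvar_def)
  next
    case (Op s t)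
    have "Poly_Mapping.single (Op s t) (1::'k) = Poly_Mapping.single s 1 \<odot> Poly_Mapping.single t 1"
      by simp
    then show ?case using Op assms(1,2) by (simp add: is_alg_hom_def del: fmul_single)
  qed
  have sums: "k (\<Sum>t\<in>A. fscale (c t) (Poly_Mapping.single t 1)) =
      (\<Sum>t\<in>A. scale' (c t) (k (Poly_Mapping.single t 1)))"
    if k: "is_alg_hom fscale fmul scale' mul' k" for k :: "('x, 'k) free_nonassoc \<Rightarrow> 'b" and A c
  proof -
    have "k (0 + 0) = k 0 + k 0" using k unfolding is_alg_hom_def by blast
    then have "k 0 = 0" by simp
    then show ?thesis using k
      by (induction A rule: infinite_finite_induct) (simp_all add: is_alg_hom_def)
  qed
  show ?thesis
    by (subst (1 2) free_nonassoc_sum[of f]) (simp only: sums[OF assms(1)] sums[OF assms(2)] mono)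
qed

context second_type_assoc_algebra
begin

lemma feval_as2_ideal:
  assumes "f \<in> as2_ideal"
  shows "feval scale mul \<phi> f = 0"
proof -
  have "is_ideal {f. feval scale mul \<phi> f = 0}"
    by (auto simp: is_ideal_def feval_add feval_fscale feval_fmul)
  moreover have "second_type_relators \<subseteq> {f. feval scale mul \<phi> f = 0}"
    unfolding second_type_relators_def
    by (auto simp: feval_add feval_diff feval_fmul second_type) (simp add: mul_assoc)
  ultimately show ?thesis using assms unfolding as2_ideal_def ideal_generated_def by blast
qed

theorem as2_universal:
  fixes \<phi> :: "'x \<Rightarrow> 'a"
  shows "\<exists>!h. is_alg_hom (as2_scale :: 'k \<Rightarrow> ('x, 'k) as2 \<Rightarrow> _) (*) scale mul h \<and>
    (\<forall>x. h (as2_gen x) = \<phi> x)"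
proof (rule ex_ex1I)
  define h where "h = (\<lambda>a :: ('x, 'k) as2. feval scale mul \<phi> (rep_as2 a))"
  have h_abs: "h (abs_as2 f) = feval scale mul \<phi> f" for f
  proof -
    have "as2_rel (rep_as2 (abs_as2 f)) f" 
      by (rule rep_abs_rsp_left[OF Quotient3_as2]) (simp add: as2_rel_def)
    then show ?thesis
      using feval_as2_ideal[of "rep_as2 (abs_as2 f) - f" \<phi>]
      by (simp add: h_def as2_rel_def feval_diff)
  qed
  have "is_alg_hom as2_scale (*) scale mul h"
    unfolding is_alg_hom_def
  proof (intro conjI allI)
    fix a b :: "('x, 'k) as2" and c
    obtain f g where [simp]: "a = abs_as2 f" "b = abs_as2 g"
      by (rule as2_abs_cases[of a], rule as2_abs_cases[of b])
    show "h (a + b) = h a + h b" "h (as2_scale c a) = scale c (h a)" "h (a * b) = mul (h a) (h b)"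
      by (simp_all add: plus_as2.abs_eq as2_scale.abs_eq times_as2.abs_eq h_abs
          feval_add feval_fscale feval_fmul)
  qed
  then show "\<exists>h. is_alg_hom as2_scale (*) scale mul (h :: ('x, 'k) as2 \<Rightarrow> _) \<and>
      (\<forall>x. h (as2_gen x) = \<phi> x)"
    by (intro exI[of _ h]) (simp add: as2_gen.abs_eq h_abs)
next
  fix h h' :: "('x, 'k) as2 \<Rightarrow> 'a"
  assume *: "is_alg_hom as2_scale (*) scale mul h \<and> (\<forall>x. h (as2_gen x) = \<phi> x)"
    "is_alg_hom as2_scale (*) scale mul h' \<and> (\<forall>x. h' (as2_gen x) = \<phi> x)"
  have hom: "is_alg_hom fscale fmul scale mul (\<lambda>f. k (abs_as2 f))"
    if "is_alg_hom as2_scale (*) scale mul k" for k :: "('x, 'k) as2 \<Rightarrow> 'a"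
    using that unfolding is_alg_hom_def
    by (simp add: plus_as2.abs_eq[symmetric] as2_scale.abs_eq[symmetric] times_as2.abs_eq[symmetric])
  have gen: "h (abs_as2 (fvar x)) = h' (abs_as2 (fvar x))" for x
    using * by (simp flip: as2_gen.abs_eq)
  have "h (abs_as2 f) = h' (abs_as2 f)" for f
    by (rule alg_hom_unique_free[OF hom[OF conjunct1[OF *(1)]] hom[OF conjunct1[OF *(2)]] gen])
  moreover have "a = abs_as2 (rep_as2 a)" for a :: "('x, 'k) as2"
    by (rule Quotient3_abs_rep[OF Quotient3_as2, symmetric])
  ultimately show "h = h'" by (intro ext) metis
qed

end


section \<open>Commutator algebra and its identities\<close>

definition commutator :: "'a::ring \<Rightarrow> 'a \<Rightarrow> 'a" where
  "commutator a b = a * b - b * a"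

definition anticommutativity :: "(nat, 'k::field) free_nonassoc" where
  "anticommutativity = fvar 0 \<odot> fvar 1 + fvar 1 \<odot> fvar 0"

definition jacobi :: "(nat, 'k::field) free_nonassoc" where
  "jacobi = (fvar 0 \<odot> fvar 1) \<odot> fvar 2 + (fvar 1 \<odot> fvar 2) \<odot> fvar 0 + (fvar 2 \<odot> fvar 0) \<odot> fvar 1"

definition metabelian :: "(nat, 'k::field) free_nonassoc" where
  "metabelian = (fvar 0 \<odot> fvar 1) \<odot> (fvar 2 \<odot> fvar 3)"

end

theory Submission
  imports Defs "HOL-Library.Multiset" "HOL-Library.Product_Plus"
begin

text \<open>
  The second-type identity is the vanishing of the standard polynomial \<open>s(a,b,c)\<close>, the alternating
  sum of the six products of three elements. Multiples of values of \<open>s\<close> and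
  values of \<open>s\<close> at Jordan products \<open>xy + yx\<close> add up to \<open>4[[a,b],[c,d]]\<close>
  (\<open>metabelian_from_standard3\<close>); the other two identities hold for the commutator of every
  associative product.

  For the converse, one second-type algebra is enough. Since \<open>s(a,b,c) = [a,b]c + [b,c]a + [c,a]b\<close>,
  an associative algebra with \<open>[a,b]c = 0\<close> is of second type. Such an algebra arises from a
  commutative algebra \<open>R\<close> and an \<open>R\<close>-module \<open>M\<close>: on \<open>R \<times> M\<close> take \<open>(p,q)(p',q') = (pp',pq')\<close>. Let
  \<open>R\<close> be the polynomials in \<open>a\<^sub>0, a\<^sub>1, \<dots>\<close>, let \<open>M\<close> be free with basis \<open>e\<^sub>0, e\<^sub>1, \<dots>\<close>, and evaluate the
  \<open>i\<close>-th variable at \<open>(a\<^sub>i, e\<^sub>i)\<close>. Then \<open>[x\<^sub>i,x\<^sub>j]\<close> becomes \<open>(0, a\<^sub>i e\<^sub>j - a\<^sub>j e\<^sub>i)\<close>, and bracketing a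
  commutator on the left with \<open>x\<^sub>k\<close> multiplies its second component by \<open>a\<^sub>k\<close>: this is the Magnus embedding of the free metabelian
  Lie algebra. The point to prove is that nothing more than the metabelian Lie identities is lost,
  that is, that the value of a polynomial in any metabelian Lie algebra \<open>L\<close> can be recovered from its
  value in the model.

  In \<open>L\<close> the operators \<open>[x\<^sub>k, _]\<close> commute on commutators (\<open>ad_commute\<close>), so monomials \<open>a\<^sup>J\<close> act on
  \<open>[L,L]\<close>. The inverse is the Koszul homotopy, divided by the total degree:
  \<open>a\<^sup>J e\<^sub>i\<close> is sent to \<open>1/(|J|+1)\<close> times the sum over \<open>k\<close> in \<open>J\<close> of \<open>a\<^sup>J\<^sup>-\<^sup>k [x\<^sub>k,x\<^sub>i]\<close>. Euler's formula
  together with the Jacobi identity shows that \<open>a\<^sup>J(a\<^sub>i e\<^sub>j - a\<^sub>j e\<^sub>i)\<close> is sent to \<open>a\<^sup>J[x\<^sub>i,x\<^sub>j]\<close>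
  (\<open>lift_mon_euler\<close>), and induction on words extends this to all values (\<open>lift_word\<close>). Taking for
  \<open>L\<close> the free nonassociative algebra modulo the T-ideal of the three identities gives the theorem.
\<close>

section \<open>The commutator algebra of a second-type associative algebra\<close>

definition bracket :: "('a::ab_group_add \<Rightarrow> 'a \<Rightarrow> 'a) \<Rightarrow> 'a \<Rightarrow> 'a \<Rightarrow> 'a" where
  "bracket mul a b = mul a b - mul b a"

lemma commutator_eq_bracket: "commutator = bracket (*)"
  by (intro ext) (simp add: commutator_def bracket_def)

context nonassoc_algebra
begin

lemma mul_minus_right: "mul a (- b) = - mul a b"
  using mul_add_right[of a b "- b"] by (simp add: eq_neg_iff_add_eq_0 add.commute)

lemma mul_diff_right: "mul a (b - c) = mul a b - mul a c"
  using mul_add_right[of a b "- c"] by (simp add: mul_minus_right)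

lemma nonassoc_algebra_bracket: "nonassoc_algebra scale (bracket mul)"
  by unfold_locales
    (simp_all add: bracket_def mul_add_left mul_add_right mul_scale_left mul_scale_right
      scale_right_diff_distrib)

end

lemma magma_eval_hom:
  assumes "is_alg_hom scale mul scale' mul' h"
  shows "h (magma_eval (bracket mul) \<phi> t) = magma_eval (bracket mul') (h \<circ> \<phi>) t"
proof -
  have add: "h (a + b) = h a + h b" and mult: "h (mul a b) = mul' (h a) (h b)" for a b
    using assms by (simp_all add: is_alg_hom_def)
  have "h (a - b) = h a - h b" for a b
    using add[of "a - b" b] by (simp add: eq_diff_eq)
  then show ?thesis
    by (induction t) (simp_all add: bracket_def mult)
qed

lemma feval_hom:
  fixes \<phi> :: "'c \<Rightarrow> 'a::ab_group_add"
  assumes "is_alg_hom scale mul scale' mul' h"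
  shows "h (feval scale (bracket mul) \<phi> f) = feval scale' (bracket mul') (h \<circ> \<phi>) f"
proof -
  have add: "h (a + b) = h a + h b" and sc: "h (scale c a) = scale' c (h a)" for a b c
    using assms by (simp_all add: is_alg_hom_def)
  have "h 0 = 0" using add[of 0 0] by simp
  then have "h (\<Sum>t\<in>A. g t) = (\<Sum>t\<in>A. h (g t))" for g and A :: "'c magma set"
    by (induction A rule: infinite_finite_induct) (simp_all add: add)
  then show ?thesis
    by (simp add: feval_def sc magma_eval_hom[OF assms])
qed

interpretation as2_lie: nonassoc_algebra "as2_scale :: 'k::field \<Rightarrow> ('x, 'k) as2 \<Rightarrow> _" commutator
  unfolding commutator_eq_bracket by (rule as2.nonassoc_algebra_bracket)

definition standard3 :: "'a::ring \<Rightarrow> 'a \<Rightarrow> 'a \<Rightarrow> 'a" where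
  "standard3 a b c = a * b * c - b * a * c - a * c * b + c * a * b + b * c * a - c * b * a"

text \<open>The coefficients solve the linear system for \<open>[[a,b],[c,d]]\<close> in the span of the multilinear
  degree-four consequences of the standard identity. Both sides change sign under exchanging
  \<open>a\<close> with \<open>b\<close> and under exchanging \<open>c\<close> with \<open>d\<close>. Multiples are written as repeated sums because
  the ring need not have a unit.\<close>

lemma metabelian_from_standard3:
  fixes a b c d :: "'a::ring"
  defines "J \<equiv> \<lambda>x y. x * y + y * x"
  defines "u \<equiv> commutator (commutator a b) (commutator c d)"
  defines "v \<equiv> J a (standard3 b c d) - J b (standard3 a c d)"
  shows "u + u + u + u = v + v + v
    + standard3 (J a c) b d - standard3 (J a d) b c - standard3 (J b c) a d + standard3 (J b d) a c"
  unfolding assms commutator_def standard3_def by (simp add: algebra_simps)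

lemma commutator_metabelian:
  fixes a b c d :: "('x, 'k::field_char_0) as2"
  shows "commutator (commutator a b) (commutator c d) = 0"
proof -
  let ?u = "commutator (commutator a b) (commutator c d)"
  have "standard3 p q r = 0" for p q r :: "('x, 'k) as2"
    using as2.second_type[of p q r] by (simp add: standard3_def)
  then have "?u + ?u + ?u + ?u = 0"
    using metabelian_from_standard3[of a b c d] by simp
  moreover have "?u + ?u + ?u + ?u = as2_scale (1 + 1 + 1 + 1) ?u"
    by (simp only: as2.scale_left_distrib as2.scale_one)
  ultimately have "as2_scale 4 ?u = 0" by simp
  then show ?thesis by simp
qed

lemma commutator_identities:
  fixes f :: "(nat, 'k::field_char_0) free_nonassoc"
  assumes "f \<in> {anticommutativity, jacobi, metabelian}"
  shows "is_identity as2_scale (commutator :: ('x, 'k) as2 \<Rightarrow> ('x, 'k) as2 \<Rightarrow> ('x, 'k) as2) f"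
proof -
  have "commutator a b + commutator b a = 0" for a b :: "('x, 'k) as2"
    by (simp add: commutator_def)
  moreover have "commutator (commutator a b) c + commutator (commutator b c) a
      + commutator (commutator c a) b = 0" for a b c :: "('x, 'k) as2"
    by (simp add: commutator_def algebra_simps)
  ultimately show ?thesis
    using assms commutator_metabelian
    by (auto simp: is_identity_def anticommutativity_def jacobi_def metabelian_def
        as2_lie.feval_add as2_lie.feval_fmul)
qed

section \<open>The polynomial model\<close>

text \<open>The module is put inside a commutative ring, so that associativity and bilinearity come from
  the ring laws: in \<open>K[a\<^sub>0, a\<^sub>1, \<dots>][z]\<close> the powers \<open>z\<^sup>i\<close> serve as the basis elements \<open>e\<^sub>i\<close>, and the
  monomial \<open>a\<^sup>J z\<^sup>i\<close> is the pair \<open>(J, i)\<close>.\<close>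

type_synonym 'k pmod = "(nat multiset \<times> nat) \<Rightarrow>\<^sub>0 'k"

definition pscale :: "'k::field \<Rightarrow> 'k pmod \<Rightarrow> 'k pmod" where
  "pscale c p = Poly_Mapping.single 0 c * p"

definition model_scale :: "'k::field \<Rightarrow> 'k pmod \<times> 'k pmod \<Rightarrow> 'k pmod \<times> 'k pmod" where
  "model_scale c u = (pscale c (fst u), pscale c (snd u))"

definition model_mul :: "'k::field pmod \<times> 'k pmod \<Rightarrow> 'k pmod \<times> 'k pmod \<Rightarrow> 'k pmod \<times> 'k pmod" where
  "model_mul u v = (fst u * fst v, fst u * snd v)"

definition model_gen :: "nat \<Rightarrow> 'k::field pmod \<times> 'k pmod" where
  "model_gen i = (Poly_Mapping.single ({#i#}, 0) 1, Poly_Mapping.single ({#}, i) 1)"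

lemma pscale_mult_left: "pscale c p * q = pscale c (p * q)"
  and pscale_mult_right: "p * pscale c q = pscale c (p * q)"
  by (simp_all add: pscale_def mult_ac)

interpretation pmod: vector_space "pscale :: 'k::field \<Rightarrow> _"
proof
  show "pscale c (pscale d p) = pscale (c * d) p" for c d and p :: "'k pmod"
    by (simp add: pscale_def mult_single flip: mult.assoc)
qed (simp_all add: pscale_def distrib_left distrib_right single_add)

interpretation model: second_type_assoc_algebra "model_scale :: 'k::field \<Rightarrow> _" model_mul
  by standard
    (simp_all add: model_scale_def model_mul_def prod_eq_iff distrib_left distrib_right
      pmod.scale_right_distrib pmod.scale_left_distrib pscale_mult_left pscale_mult_right mult_ac)

text \<open>By the universal property, each evaluation in the model factors through the free algebra once
  the variables are sent injectively to its generators; this is where \<open>X\<close> has to be infinite.\<close>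

lemma model_identity:
  fixes f :: "(nat, 'k::field_char_0) free_nonassoc"
  assumes "infinite (UNIV :: 'x set)"
    and "is_identity as2_scale (commutator :: ('x, 'k) as2 \<Rightarrow> ('x, 'k) as2 \<Rightarrow> ('x, 'k) as2) f"
  shows "feval model_scale (bracket model_mul) model_gen f = 0"
proof -
  obtain e :: "nat \<Rightarrow> 'x" where e: "inj e"
    using assms(1) infinite_countable_subset by blast
  obtain h :: "('x, 'k) as2 \<Rightarrow> _"
    where h: "is_alg_hom as2_scale (*) model_scale model_mul h"
      and gen: "\<forall>x. h (as2_gen x) = model_gen (inv e x)"
    using model.as2_universal[of "\<lambda>x. model_gen (inv e x)"] by blast
  have "h \<circ> (\<lambda>n. as2_gen (e n)) = model_gen"
    using e gen by (auto simp: fun_eq_iff)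
  then have "feval model_scale (bracket model_mul) model_gen f
      = h (feval as2_scale commutator (\<lambda>n. as2_gen (e n)) f)"
    unfolding commutator_eq_bracket by (simp add: feval_hom[OF h])
  also have "\<dots> = h 0"
    using assms(2) by (simp add: is_identity_def)
  also have "\<dots> = 0"
    using h unfolding is_alg_hom_def by (metis add_cancel_right_right)
  finally show ?thesis .
qed


section \<open>Metabelian Lie algebras\<close>

locale metabelian_lie_algebra = nonassoc_algebra scale mul
  for scale :: "'k::field_char_0 \<Rightarrow> 'a::ab_group_add \<Rightarrow> 'a"
    and mul :: "'a \<Rightarrow> 'a \<Rightarrow> 'a" +
  assumes anticommute: "mul a b = - mul b a"
    and jacobi_identity: "mul (mul a b) c + mul (mul b c) a + mul (mul c a) b = 0"
    and metabelian_identity: "mul (mul a b) (mul c d) = 0"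
begin

lemma jacobi_left: "mul a (mul b c) - mul b (mul a c) = mul (mul a b) c"
proof -
  have "mul (mul b c) a = - mul a (mul b c)" by (rule anticommute)
  moreover have "mul (mul c a) b = mul b (mul a c)"
    using anticommute[of "mul c a" b] anticommute[of c a] mul_minus_right[of b "mul a c"] by simp
  ultimately have "mul (mul a b) c + - mul a (mul b c) + mul b (mul a c) = 0"
    using jacobi_identity[of a b c] by simp
  then show ?thesis by (simp add: algebra_simps)
qed

text \<open>The Jacobi identity makes the difference of the two sides a bracket of the commutators
  \<open>[a,b]\<close> and \<open>[c,d]\<close>.\<close>

lemma ad_commute: "mul a (mul b (mul c d)) = mul b (mul a (mul c d))"
  using jacobi_left[of a b "mul c d"] by (simp add: metabelian_identity)

definition ad_list :: "(nat \<Rightarrow> 'a) \<Rightarrow> nat list \<Rightarrow> 'a \<Rightarrow> 'a" where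
  "ad_list x ks v = foldr (\<lambda>k. mul (x k)) ks v"

lemma ad_list_simps [simp]:
  "ad_list x [] v = v" "ad_list x (k # ks) v = mul (x k) (ad_list x ks v)"
  "ad_list x (ks @ ls) v = ad_list x ks (ad_list x ls v)"
  by (simp_all add: ad_list_def)

lemma ad_list_diff: "ad_list x ks (v - w) = ad_list x ks v - ad_list x ks w"
  by (induction ks) (simp_all add: mul_diff_right)

lemma ad_list_minus: "ad_list x ks (- v) = - ad_list x ks v"
  by (induction ks) (simp_all add: mul_minus_right)

lemma ad_list_zero [simp]: "ad_list x ks 0 = 0"
  by (induction ks) simp_all

lemma ad_list_product: "\<exists>c d. ad_list x ks (mul a b) = mul c d"
  by (cases ks) auto

lemma ad_list_move: "ad_list x us (mul (x k) (mul a b)) = mul (x k) (ad_list x us (mul a b))"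
proof (induction us)
  case (Cons u us)
  obtain c d where "ad_list x us (mul a b) = mul c d"
    using ad_list_product by blast
  then show ?case using Cons ad_commute by simp
qed simp

lemma ad_list_mset_cong:
  assumes "mset ks = mset ls"
  shows "ad_list x ks (mul a b) = ad_list x ls (mul a b)"
  using assms
proof (induction ks arbitrary: ls)
  case (Cons k ks)
  then have "k \<in> set ls" by (metis list.set_intros(1) set_mset_mset)
  then obtain us vs where ls: "ls = us @ k # vs" by (meson split_list)
  then have "mset ks = mset (us @ vs)" using Cons.prems by simp
  then have "ad_list x (k # ks) (mul a b) = mul (x k) (ad_list x us (ad_list x vs (mul a b)))"
    using Cons.IH[of "us @ vs"] by simp
  moreover obtain c d where "ad_list x vs (mul a b) = mul c d"
    using ad_list_product by blast
  ultimately show ?case by (simp add: ls ad_list_move)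
qed simp

text \<open>On commutators the order of the operators is immaterial by \<open>ad_list_mset_cong\<close>, so sorting is
  merely a choice of representative; only the values on commutators are meant.\<close>

definition ad_mset :: "(nat \<Rightarrow> 'a) \<Rightarrow> nat multiset \<Rightarrow> 'a \<Rightarrow> 'a" where
  "ad_mset x J v = ad_list x (sorted_list_of_multiset J) v"

lemma ad_mset_mset: "ad_mset x (mset ks) (mul a b) = ad_list x ks (mul a b)"
  unfolding ad_mset_def by (rule ad_list_mset_cong) simp

lemma ad_mset_add: "ad_mset x (add_mset k J) (mul a b) = ad_mset x J (mul (x k) (mul a b))"
proof -
  obtain ks where J: "J = mset ks" using ex_mset by metis
  have "ad_mset x (add_mset k J) (mul a b) = ad_list x (ks @ [k]) (mul a b)"
    unfolding J using ad_mset_mset[of x "ks @ [k]"] by simp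
  then show ?thesis by (simp add: J ad_mset_mset)
qed

text \<open>The Koszul homotopy divided by the Euler factor, on the monomial \<open>a\<^sup>J e\<^sub>i\<close>. For empty \<open>J\<close> the
  sum would be \<open>0\<close>; the value \<open>x\<^sub>i\<close> makes the map right on single variables as well.\<close>

definition lift_mon :: "(nat \<Rightarrow> 'a) \<Rightarrow> nat multiset \<times> nat \<Rightarrow> 'a" where
  "lift_mon x m = (case m of (J, i) \<Rightarrow>
     if J = {#} then x i
     else scale (inverse (of_nat (size J + 1)))
       (\<Sum>k\<in>#J. ad_mset x (J - {#k#}) (mul (x k) (x i))))"

definition lift_pmod :: "(nat \<Rightarrow> 'a) \<Rightarrow> 'k pmod \<Rightarrow> 'a" where
  "lift_pmod x q = (\<Sum>m\<in>Poly_Mapping.keys q. scale (Poly_Mapping.lookup q m) (lift_mon x m))"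

lemma lift_pmod_superset:
  assumes "finite A" "Poly_Mapping.keys q \<subseteq> A"
  shows "lift_pmod x q = (\<Sum>m\<in>A. scale (Poly_Mapping.lookup q m) (lift_mon x m))"
  unfolding lift_pmod_def using assms by (intro sum.mono_neutral_left) (auto simp: in_keys_iff)

lemma lift_pmod_single: "lift_pmod x (Poly_Mapping.single m c) = scale c (lift_mon x m)"
  by (subst lift_pmod_superset[of "{m}"]) auto

lemma lift_pmod_zero [simp]: "lift_pmod x 0 = 0"
  by (simp add: lift_pmod_def)

lemma lift_pmod_add: "lift_pmod x (p + q) = lift_pmod x p + lift_pmod x q"
proof -
  let ?U = "Poly_Mapping.keys p \<union> Poly_Mapping.keys q"
  have "finite ?U" "Poly_Mapping.keys (p + q) \<subseteq> ?U" by (simp_all add: Poly_Mapping.keys_add)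
  then show ?thesis
    by (simp add: lift_pmod_superset[of ?U] lookup_add scale_left_distrib sum.distrib)
qed

lemma lift_pmod_minus: "lift_pmod x (- p) = - lift_pmod x p"
  using lift_pmod_add[of x p "- p"] by (simp add: eq_neg_iff_add_eq_0 add.commute)

lemma lift_pmod_diff: "lift_pmod x (p - q) = lift_pmod x p - lift_pmod x q"
  using lift_pmod_add[of x p "- q"] by (simp add: lift_pmod_minus)

lemma lift_pmod_scale: "lift_pmod x (pscale c p) = scale c (lift_pmod x p)"
proof -
  have lookup: "Poly_Mapping.lookup (pscale c p) m = c * Poly_Mapping.lookup p m" for m
  proof -
    have "pscale c p = Poly_Mapping.map ((*) c) p"
      by (simp add: pscale_def mult_map_scale_conv_mult)
    then show ?thesis by (simp add: Poly_Mapping.map.rep_eq when_def)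
  qed
  then have "Poly_Mapping.keys (pscale c p) \<subseteq> Poly_Mapping.keys p"
    by (auto simp: in_keys_iff)
  then show ?thesis
    by (simp add: lift_pmod_superset[of "Poly_Mapping.keys p"] lookup scale_sum_right)
qed

lemma lift_pmod_sum: "lift_pmod x (sum g A) = (\<Sum>i\<in>A. lift_pmod x (g i))"
  by (induction A rule: infinite_finite_induct) (simp_all add: lift_pmod_add)

text \<open>For \<open>n = |J| + 2\<close>, the term \<open>k = i\<close> of the first sum and the term \<open>k = j\<close> of the second each
  contribute one copy of \<open>a\<^sup>J[x\<^sub>i,x\<^sub>j]\<close>. For \<open>k\<close> in \<open>J\<close>, the Jacobi identity
  \<open>[x\<^sub>i,[x\<^sub>k,x\<^sub>j]] - [x\<^sub>j,[x\<^sub>k,x\<^sub>i]] = [x\<^sub>k,[x\<^sub>i,x\<^sub>j]]\<close> gives one more copy each. The \<open>n\<close> copies cancel the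
  factor \<open>1/n\<close>, which is where characteristic \<open>0\<close> enters.\<close>

lemma lift_mon_euler:
  "lift_mon x (add_mset i J, j) - lift_mon x (add_mset j J, i) = ad_mset x J (mul (x i) (x j))"
proof -
  let ?w = "ad_mset x J (mul (x i) (x j))"
  let ?S = "\<lambda>i j. \<Sum>k\<in>#J. ad_mset x (add_mset i J - {#k#}) (mul (x k) (x j))"
  have sum_const: "(\<Sum>k\<in>#J'. v) = scale (of_nat (size J')) v" for J' :: "nat multiset" and v
    by (induction J') (simp_all add: scale_left_distrib)
  have diff: "ad_mset x (add_mset i J - {#k#}) (mul (x k) (x j))
      - ad_mset x (add_mset j J - {#k#}) (mul (x k) (x i)) = ?w" if "k \<in># J" for k
  proof -
    obtain J' where J: "J = add_mset k J'" using multi_member_split[OF \<open>k \<in># J\<close>] by blast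
    have "ad_mset x J' (mul (x i) (mul (x k) (x j))) - ad_mset x J' (mul (x j) (mul (x k) (x i)))
        = ad_mset x J' (mul (x k) (mul (x i) (x j)))"
    proof -
      have "mul (x i) (mul (x k) (x j)) - mul (x j) (mul (x k) (x i)) = mul (x k) (mul (x i) (x j))"
        unfolding anticommute[of "x j" "mul (x k) (x i)"]
        using jacobi_left[of "x k" "x i" "x j"] by (simp add: algebra_simps)
      then show ?thesis
        unfolding ad_mset_def ad_list_diff[symmetric] by (rule arg_cong)
    qed
    moreover have "add_mset l J - {#k#} = add_mset l J'" for l
      unfolding J add_mset_commute[of l k] by (rule add_mset_remove_trivial)
    ultimately show ?thesis
      by (simp add: J ad_mset_add)
  qed
  have "?S i j = (\<Sum>k\<in>#J. ad_mset x (add_mset j J - {#k#}) (mul (x k) (x i)) + ?w)"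
    by (intro arg_cong[where f = sum_mset] image_mset_cong) (simp add: diff[symmetric])
  also have "\<dots> = ?S j i + (\<Sum>k\<in>#J. ?w)"
    by (rule sum_mset.distrib)
  also have "(\<Sum>k\<in>#J. ?w) = scale (of_nat (size J)) ?w"
    using sum_const .
  finally have S: "?S i j = ?S j i + scale (of_nat (size J)) ?w" .
  have anti: "ad_mset x J (mul (x j) (x i)) = - ?w"
    using anticommute[of "x j" "x i"] by (simp add: ad_mset_def ad_list_minus)
  have "lift_mon x (add_mset i J, j) - lift_mon x (add_mset j J, i)
     = scale (inverse (of_nat (size J + 2))) ((?w + ?S i j) - (- ?w + ?S j i))"
    by (simp add: lift_mon_def anti scale_right_diff_distrib)
  also have "(?w + ?S i j) - (- ?w + ?S j i) = scale (of_nat (size J + 2)) ?w"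
    using S scale_left_distrib[of 1 1 ?w] by (simp add: algebra_simps scale_left_distrib)
  also have "scale (inverse (of_nat (size J + 2))) (scale (of_nat (size J + 2)) ?w) = ?w"
  proof -
    have "of_nat (size J + 2) \<noteq> (0 :: 'k)" unfolding of_nat_eq_0_iff by simp
    from left_inverse[OF this] show ?thesis by (simp only: scale_scale scale_one)
  qed
  finally show ?thesis .
qed

text \<open>The map \<open>lift_pmod\<close> does not turn multiplication by \<open>a\<^sub>k\<close> into \<open>[x\<^sub>k, _]\<close> on the whole module,
  only on values of commutator words. Multiplying by an arbitrary monomial in the statement makes
  the induction carry this property along: a bracket with a single variable just lengthens the
  monomial, and a bracket of two commutators vanishes on both sides.\<close>

lemma lift_commutator_word:
  fixes x :: "nat \<Rightarrow> 'a" and s t :: "nat magma"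
  defines "E \<equiv> magma_eval (bracket model_mul) (model_gen :: nat \<Rightarrow> 'k pmod \<times> 'k pmod)"
  shows "fst (E (Op s t)) = 0 \<and>
    (\<forall>ks. lift_pmod x (Poly_Mapping.single (mset ks, 0) 1 * snd (E (Op s t)))
       = ad_list x ks (magma_eval mul x (Op s t)))"
    (is "_ \<and> (\<forall>ks. ?P ks s t)")
proof (induction "Op s t" arbitrary: s t)
  case (Op s t)
  have fst: "fst (E (Op s t)) = 0"
    by (simp add: E_def bracket_def model_mul_def mult.commute)
  have snd: "snd (E (Op s t)) = fst (E s) * snd (E t) - fst (E t) * snd (E s)"
    by (simp add: E_def bracket_def model_mul_def)
  have gen: "E (Gen i) = (Poly_Mapping.single ({#i#}, 0) 1, Poly_Mapping.single ({#}, i) 1)" for i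
    by (simp add: E_def model_gen_def)
  \<comment> \<open>The new operator acts first, hence the variable goes to the end of the list.\<close>
  have act: "Poly_Mapping.single (mset ks, 0) 1 * (Poly_Mapping.single ({#i#}, 0) 1 * q)
      = Poly_Mapping.single (mset (ks @ [i]), 0) 1 * q" for ks i and q :: "'k pmod"
    by (simp add: mult_single flip: mult.assoc)
  have "?P ks s t" for ks
  proof (cases s)
    case s: (Gen i)
    show ?thesis
    proof (cases t)
      case t: (Gen j)
      have "lift_pmod x (Poly_Mapping.single (mset ks, 0) 1 * snd (E (Op s t)))
          = lift_mon x (add_mset i (mset ks), j) - lift_mon x (add_mset j (mset ks), i)"
        unfolding snd
        by (simp add: s t gen right_diff_distrib act mult_single lift_pmod_diff lift_pmod_single)
      then show ?thesis by (simp add: s t lift_mon_euler ad_mset_mset)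
    next
      case t: (Op t1 t2)
      show ?thesis
        using Op(2)[OF t, THEN conjunct1] Op(2)[OF t, THEN conjunct2, rule_format, of "ks @ [i]"] 
        unfolding snd by (simp add: s t gen act)
    qed
  next
    case s: (Op s1 s2)
    note IHs = Op(1)[OF s]
    show ?thesis
    proof (cases t)
      case t: (Gen j)
      show ?thesis
        using IHs[THEN conjunct1] IHs[THEN conjunct2, rule_format, of "ks @ [j]"]
          anticommute[of "mul (magma_eval mul x s1) (magma_eval mul x s2)" "x j"]
        unfolding snd by (simp add: s t gen act lift_pmod_minus ad_list_minus)
    next
      case t: (Op t1 t2)
      show ?thesis
        using IHs[THEN conjunct1] Op(2)[OF t, THEN conjunct1]
        unfolding snd by (simp add: s t metabelian_identity)
    qed
  qed
  with fst show ?case by blast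
qed

lemma lift_word:
  "lift_pmod x (snd (magma_eval (bracket model_mul) model_gen t)) = magma_eval mul x t"
proof (cases t)
  case (Gen i)
  then show ?thesis by (simp add: model_gen_def lift_pmod_single lift_mon_def)
next
  case (Op s u)
  have "Poly_Mapping.single ({#} :: nat multiset, 0 :: nat) (1::'k) = 1"
    by (metis single_one zero_prod_def zero_multiset_def)
  then show ?thesis
    using lift_commutator_word[where x = x and s = s and t = u, THEN conjunct2, rule_format, of "[]"]
    by (simp add: Op)
qed

text \<open>By linearity, \<open>lift_word\<close> gives the value of \<open>f\<close> in \<open>L\<close> from its value in the model.\<close>

lemma model_identity_imp_identity:
  assumes "feval model_scale (bracket model_mul) model_gen f = 0"
  shows "feval scale mul x f = 0"
proof -
  have snd_sum: "snd (sum g A) = (\<Sum>i\<in>A. snd (g i))" for g :: "nat magma \<Rightarrow> 'k pmod \<times> 'k pmod" and A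
    by (induction A rule: infinite_finite_induct) simp_all
  have "feval scale mul x f = lift_pmod x (snd (feval model_scale (bracket model_mul) model_gen f))"
    by (simp add: feval_def snd_sum model_scale_def lift_pmod_sum lift_pmod_scale lift_word)
  then show ?thesis using assms by simp
qed

end


section \<open>The free metabelian Lie algebra\<close>

text \<open>A polynomial lies in the T-ideal exactly when its generic value in the quotient is \<open>0\<close>, so the
  quotient must be available as a metabelian Lie algebra in its own right.\<close>

abbreviation lie_ideal :: "(nat, 'k::field) free_nonassoc set" where
  "lie_ideal \<equiv> T_ideal_generated {anticommutativity, jacobi, metabelian}"

lemma is_T_ideal_generated: "is_T_ideal (T_ideal_generated G)"
  unfolding is_T_ideal_def is_ideal_def T_ideal_generated_def by blast

lemma T_ideal_generated_instance:
  assumes "f \<in> G"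
  shows "feval fscale fmul \<sigma> f \<in> T_ideal_generated G"
  using assms is_T_ideal_generated[of G] unfolding is_T_ideal_def T_ideal_generated_def by blast

lemma lie_ideal_zero: "0 \<in> lie_ideal"
  and lie_ideal_add: "f \<in> lie_ideal \<Longrightarrow> g \<in> lie_ideal \<Longrightarrow> f + g \<in> lie_ideal"
  and lie_ideal_diff: "f \<in> lie_ideal \<Longrightarrow> g \<in> lie_ideal \<Longrightarrow> f - g \<in> lie_ideal"
  and lie_ideal_fscale: "f \<in> lie_ideal \<Longrightarrow> fscale c f \<in> lie_ideal"
  and lie_ideal_mul_left: "f \<in> lie_ideal \<Longrightarrow> h \<odot> f \<in> lie_ideal"
  and lie_ideal_mul_right: "f \<in> lie_ideal \<Longrightarrow> f \<odot> h \<in> lie_ideal"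
  using is_T_ideal_generated[of "{anticommutativity, jacobi, metabelian}"] is_ideal_diff
  unfolding is_T_ideal_def is_ideal_def by blast+

lemma lie_ideal_anticommutativity: "f \<odot> g + g \<odot> f \<in> lie_ideal"
  and lie_ideal_jacobi: "(f \<odot> g) \<odot> h + (g \<odot> h) \<odot> f + (h \<odot> f) \<odot> g \<in> lie_ideal"
  and lie_ideal_metabelian: "(f \<odot> g) \<odot> (h \<odot> k) \<in> lie_ideal"
proof -
  let ?\<sigma> = "\<lambda>n::nat. if n = 0 then f else if n = 1 then g else if n = 2 then h else k"
  note inst = T_ideal_generated_instance[where \<sigma> = ?\<sigma> and G = "{anticommutativity, jacobi, metabelian}"]
  show "f \<odot> g + g \<odot> f \<in> lie_ideal"
    using inst[of anticommutativity]
    by (simp add: anticommutativity_def free_alg.feval_add free_alg.feval_fmul)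
  show "(f \<odot> g) \<odot> h + (g \<odot> h) \<odot> f + (h \<odot> f) \<odot> g \<in> lie_ideal"
    using inst[of jacobi]
    by (simp add: jacobi_def free_alg.feval_add free_alg.feval_fmul)
  show "(f \<odot> g) \<odot> (h \<odot> k) \<in> lie_ideal"
    using inst[of metabelian]
    by (simp add: metabelian_def free_alg.feval_fmul)
qed

definition lie_rel :: "(nat, 'k::field) free_nonassoc \<Rightarrow> (nat, 'k) free_nonassoc \<Rightarrow> bool" where
  "lie_rel f g \<longleftrightarrow> f - g \<in> lie_ideal"

lemma equivp_lie_rel: "equivp lie_rel"
proof (intro equivpI reflpI sympI transpI)
  fix f g h :: "(nat, 'k::field) free_nonassoc"
  show "lie_rel f f" by (simp add: lie_rel_def lie_ideal_zero)
  show "lie_rel g f" if "lie_rel f g"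
    using that lie_ideal_diff[OF lie_ideal_zero, of "f - g"] by (simp add: lie_rel_def)
  show "lie_rel f h" if "lie_rel f g" "lie_rel g h"
    using that lie_ideal_add[of "f - g" "g - h"] by (simp add: lie_rel_def)
qed

quotient_type (overloaded) 'k free_metabelian = "(nat, 'k::field) free_nonassoc" / lie_rel
  by (rule equivp_lie_rel)

instantiation free_metabelian :: (field) ab_group_add
begin

lift_definition zero_free_metabelian :: "'a free_metabelian" is 0 .

lift_definition plus_free_metabelian ::
  "'a free_metabelian \<Rightarrow> 'a free_metabelian \<Rightarrow> 'a free_metabelian" is "(+)"
proof -
  fix f f' g g' :: "(nat, 'a) free_nonassoc" assume "lie_rel f f'" "lie_rel g g'"
  then have "(f - f') + (g - g') \<in> lie_ideal" unfolding lie_rel_def by (rule lie_ideal_add)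
  then show "lie_rel (f + g) (f' + g')" by (simp add: lie_rel_def algebra_simps)
qed

lift_definition minus_free_metabelian ::
  "'a free_metabelian \<Rightarrow> 'a free_metabelian \<Rightarrow> 'a free_metabelian" is "(-)"
proof -
  fix f f' g g' :: "(nat, 'a) free_nonassoc" assume "lie_rel f f'" "lie_rel g g'"
  then have "(f - f') - (g - g') \<in> lie_ideal" unfolding lie_rel_def by (rule lie_ideal_diff)
  then show "lie_rel (f - g) (f' - g')" by (simp add: lie_rel_def algebra_simps)
qed

lift_definition uminus_free_metabelian :: "'a free_metabelian \<Rightarrow> 'a free_metabelian" is uminus
proof -
  fix f f' :: "(nat, 'a) free_nonassoc" assume "lie_rel f f'"
  then have "0 - (f - f') \<in> lie_ideal"
    unfolding lie_rel_def by (rule lie_ideal_diff[OF lie_ideal_zero])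
  then show "lie_rel (- f) (- f')" by (simp add: lie_rel_def)
qed

instance
  by standard (transfer; simp add: lie_rel_def lie_ideal_zero algebra_simps)+

end

lift_definition lie_mul :: "'k::field free_metabelian \<Rightarrow> 'k free_metabelian \<Rightarrow> 'k free_metabelian"
  is fmul
proof -
  fix f f' g g' :: "(nat, 'k) free_nonassoc" assume "lie_rel f f'" "lie_rel g g'"
  then have "(f - f') \<odot> g + f' \<odot> (g - g') \<in> lie_ideal"
    unfolding lie_rel_def by (intro lie_ideal_add lie_ideal_mul_left lie_ideal_mul_right)
  then show "lie_rel (f \<odot> g) (f' \<odot> g')"
    by (simp add: lie_rel_def fmul_diff_left fmul_diff_right)
qed

lift_definition lie_scale :: "'k::field \<Rightarrow> 'k free_metabelian \<Rightarrow> 'k free_metabelian" is fscale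
proof -
  fix c and f f' :: "(nat, 'k) free_nonassoc" assume "lie_rel f f'"
  then have "fscale c (f - f') \<in> lie_ideal" unfolding lie_rel_def by (rule lie_ideal_fscale)
  then show "lie_rel (fscale c f) (fscale c f')"
    by (simp add: lie_rel_def free_vs.scale_right_diff_distrib)
qed

interpretation free_metabelian:
  metabelian_lie_algebra "lie_scale :: 'k::field_char_0 \<Rightarrow> _" lie_mul
proof
  fix a b c d :: "'k free_metabelian"
  show "lie_mul a b = - lie_mul b a"
    by transfer (simp add: lie_rel_def lie_ideal_anticommutativity)
  show "lie_mul (lie_mul a b) c + lie_mul (lie_mul b c) a + lie_mul (lie_mul c a) b = 0"
    by transfer (simp add: lie_rel_def lie_ideal_jacobi)
  show "lie_mul (lie_mul a b) (lie_mul c d) = 0"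
    by transfer (simp add: lie_rel_def lie_ideal_metabelian)
qed (transfer, simp add: lie_rel_def lie_ideal_zero free_vs.scale_right_distrib
       free_vs.scale_left_distrib free_alg.mul_add_left free_alg.mul_add_right
       free_alg.mul_scale_left free_alg.mul_scale_right)+

lemma feval_free_metabelian:
  fixes f :: "(nat, 'k::field_char_0) free_nonassoc"
  shows "feval lie_scale lie_mul (\<lambda>i. abs_free_metabelian (fvar i)) f = abs_free_metabelian f"
proof (rule alg_hom_unique_free)
  show "is_alg_hom fscale fmul lie_scale lie_mul (feval (lie_scale :: 'k \<Rightarrow> _) lie_mul
      (\<lambda>i. abs_free_metabelian (fvar i)))"
    by (simp add: is_alg_hom_def free_metabelian.feval_add free_metabelian.feval_fscale
        free_metabelian.feval_fmul)
  show "is_alg_hom fscale fmul (lie_scale :: 'k \<Rightarrow> _) lie_mul abs_free_metabelian"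
    by (simp add: is_alg_hom_def plus_free_metabelian.abs_eq lie_scale.abs_eq lie_mul.abs_eq)
qed simp

theorem theorem5:
  assumes "infinite (UNIV :: 'x set)" and "countable (UNIV :: 'x set)"
  shows "(\<forall>f \<in> {anticommutativity, jacobi, metabelian}.
            is_identity as2_scale
              (commutator :: ('x, 'k::field_char_0) as2 \<Rightarrow> ('x, 'k) as2 \<Rightarrow> ('x, 'k) as2) f) \<and>
         (\<forall>f :: (nat, 'k) free_nonassoc.
            fdegree f \<le> 4 \<and>
            is_identity as2_scale
              (commutator :: ('x, 'k) as2 \<Rightarrow> ('x, 'k) as2 \<Rightarrow> ('x, 'k) as2) f \<longrightarrow>
            f \<in> T_ideal_generated {anticommutativity, jacobi, metabelian})"
proof (intro conjI ballI allI impI)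
  fix f :: "(nat, 'k) free_nonassoc"
  assume "f \<in> {anticommutativity, jacobi, metabelian}"
  then show "is_identity as2_scale
      (commutator :: ('x, 'k) as2 \<Rightarrow> ('x, 'k) as2 \<Rightarrow> ('x, 'k) as2) f"
    by (rule commutator_identities)
next
  fix f :: "(nat, 'k) free_nonassoc"
  assume f: "fdegree f \<le> 4 \<and> is_identity as2_scale
    (commutator :: ('x, 'k) as2 \<Rightarrow> ('x, 'k) as2 \<Rightarrow> ('x, 'k) as2) f"
  have "feval model_scale (bracket model_mul) model_gen f = 0"
    using f by (intro model_identity[OF assms(1)]) blast
  then have "abs_free_metabelian f = 0"
    using free_metabelian.model_identity_imp_identity[of f "\<lambda>i. abs_free_metabelian (fvar i)"]
    by (simp only: feval_free_metabelian)
  then have "lie_rel f 0"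
    by (simp add: zero_free_metabelian_def free_metabelian.abs_eq_iff)
  then show "f \<in> T_ideal_generated {anticommutativity, jacobi, metabelian}"
    by (simp add: lie_rel_def)
qed

end
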